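(* Let $\succsim=(\succsim_1,\dots,\succsim_n)$ be a preference profile over objects. An assignment $p$ is necessarily Pareto optimal with respect to $\succsim$ if and only if (i) it is possibly Pareto optimal with respect to $\succsim$, and (ii) it does not admit a one-for-two Pareto improvement swap.
   Context: $N=\{1,\dots,n\}$ is a set of agents and $O=\{o_1,\dots,o_m\}$ a set of objects. An assignment $p=(p(1),\dots,p(n))$ is a partition of $O$ into $n$ (possibly empty) subsets, $p(i)$ being the bundle of agent $i$. Each agent $i$ has a complete, transitive, reflexive preference relation $\succsim_i$ over $O$, with strict part $\succ_i$. $\mathcal U(\succsim)$ is the set of utility profiles $u=(u_1,\dots,u_n)$ with $u_i:O\to\mathbb R_{>0}$ consistent with $\succsim_i$ (i.e. $u_i(o)\ge u_i(o')$ iff $o\succsim_i o'$), extended additively to bundles: $u_i(S)=\sum_{o\in S}u_i(o)$. For a given $u$, assignment $q$ Pareto dominates $p$ if $u_i(q(i))\ge u_i(p(i))$ for all $i$ and $u_i(q(i))>u_i(p(i))$ for some $i$; $p$ is Pareto optimal for $u$ if no assignment Pareto dominates it. $p$ is possibly (resp. necessarily) Pareto optimal with respect to $\succsim$ if $p$ is Pareto optimal for some (resp. every) $u\in\mathcal U(\succsim)$. An assignment $p$ admits a one-for-two Pareto improvement swap if there are two distinct agents $j,k$, two distinct objects $o_j^1,o_j^2\in p(j)$ and an object $o_k\in p(k)$ such that $o_k\succ_j o_j^1\succsim_j o_j^2$. *)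

theory Defs
  imports Complex_Main "HOL-Library.Disjoint_Sets"
begin

text \<open>
  The agents are \<open>{1..n}\<close> and the objects form a finite set \<open>Obj\<close>. The value
  \<open>R i x y\<close> means that agent \<open>i\<close> weakly prefers \<open>x\<close> to \<open>y\<close>. Preferences, utilities
  and assignments are total HOL functions; no definition below depends on their values at
  indices outside \<open>{1..n}\<close> or, for preferences and utilities, at elements outside \<open>Obj\<close>.
\<close>

text \<open>Completeness is \<open>totalp_on\<close>, which concerns distinct objects only, together with
  \<open>reflp_on\<close>.\<close>

definition preference_profile :: "nat \<Rightarrow> 'o set \<Rightarrow> (nat \<Rightarrow> 'o \<Rightarrow> 'o \<Rightarrow> bool) \<Rightarrow> bool" where
  "preference_profile n Obj R \<longleftrightarrow>
    (\<forall>i\<in>{1..n}. reflp_on Obj (R i) \<and> transp_on Obj (R i) \<and> totalp_on Obj (R i))"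

definition strict_pref :: "('o \<Rightarrow> 'o \<Rightarrow> bool) \<Rightarrow> 'o \<Rightarrow> 'o \<Rightarrow> bool" where
  "strict_pref r x y \<longleftrightarrow> r x y \<and> \<not> r y x"

text \<open>Bundles may be empty, so the library predicate \<open>partition_on\<close> (nonempty blocks) does
  not apply.\<close>

definition assignment :: "nat \<Rightarrow> 'o set \<Rightarrow> (nat \<Rightarrow> 'o set) \<Rightarrow> bool" where
  "assignment n Obj p \<longleftrightarrow> disjoint_family_on p {1..n} \<and> (\<Union>i\<in>{1..n}. p i) = Obj"

definition utility_profiles ::
    "nat \<Rightarrow> 'o set \<Rightarrow> (nat \<Rightarrow> 'o \<Rightarrow> 'o \<Rightarrow> bool) \<Rightarrow> (nat \<Rightarrow> 'o \<Rightarrow> real) set" where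
  "utility_profiles n Obj R =
    {u. \<forall>i\<in>{1..n}. (\<forall>x\<in>Obj. u i x > 0) \<and> (\<forall>x\<in>Obj. \<forall>y\<in>Obj. u i x \<ge> u i y \<longleftrightarrow> R i x y)}"

definition bundle_utility :: "('o \<Rightarrow> real) \<Rightarrow> 'o set \<Rightarrow> real" where
  "bundle_utility v S = (\<Sum>x\<in>S. v x)"

definition pareto_dominates ::
    "nat \<Rightarrow> (nat \<Rightarrow> 'o \<Rightarrow> real) \<Rightarrow> (nat \<Rightarrow> 'o set) \<Rightarrow> (nat \<Rightarrow> 'o set) \<Rightarrow> bool" where
  "pareto_dominates n u q p \<longleftrightarrow>
    (\<forall>i\<in>{1..n}. bundle_utility (u i) (q i) \<ge> bundle_utility (u i) (p i)) \<and>
    (\<exists>i\<in>{1..n}. bundle_utility (u i) (q i) > bundle_utility (u i) (p i))"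

definition pareto_optimal ::
    "nat \<Rightarrow> 'o set \<Rightarrow> (nat \<Rightarrow> 'o \<Rightarrow> real) \<Rightarrow> (nat \<Rightarrow> 'o set) \<Rightarrow> bool" where
  "pareto_optimal n Obj u p \<longleftrightarrow> \<not> (\<exists>q. assignment n Obj q \<and> pareto_dominates n u q p)"

definition possibly_pareto_optimal ::
    "nat \<Rightarrow> 'o set \<Rightarrow> (nat \<Rightarrow> 'o \<Rightarrow> 'o \<Rightarrow> bool) \<Rightarrow> (nat \<Rightarrow> 'o set) \<Rightarrow> bool" where
  "possibly_pareto_optimal n Obj R p \<longleftrightarrow>
    (\<exists>u\<in>utility_profiles n Obj R. pareto_optimal n Obj u p)"

definition necessarily_pareto_optimal ::
    "nat \<Rightarrow> 'o set \<Rightarrow> (nat \<Rightarrow> 'o \<Rightarrow> 'o \<Rightarrow> bool) \<Rightarrow> (nat \<Rightarrow> 'o set) \<Rightarrow> bool" where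
  "necessarily_pareto_optimal n Obj R p \<longleftrightarrow>
    (\<forall>u\<in>utility_profiles n Obj R. pareto_optimal n Obj u p)"

definition admits_one_for_two_swap ::
    "nat \<Rightarrow> (nat \<Rightarrow> 'o \<Rightarrow> 'o \<Rightarrow> bool) \<Rightarrow> (nat \<Rightarrow> 'o set) \<Rightarrow> bool" where
  "admits_one_for_two_swap n R p \<longleftrightarrow>
    (\<exists>j\<in>{1..n}. \<exists>k\<in>{1..n}. j \<noteq> k \<and>
      (\<exists>x\<in>p j. \<exists>y\<in>p j. \<exists>z\<in>p k. x \<noteq> y \<and> strict_pref (R j) z x \<and> R j x y))"

end

theory Submission
  imports Defs
begin

text \<open>
  For necessity, a one-for-two swap is a Pareto improvement once the receiver of the single object
  has utilities growing geometrically with rank and the other agent has nearly equal utilities.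

  For sufficiency, let \<open>q\<close> dominate \<open>p\<close> under \<open>u\<close>. Without a one-for-two swap, only the worst
  object \<open>w i\<close> that agent \<open>i\<close> gives up can be worse than an object that \<open>i\<close> receives. Hence no agent
  receives fewer objects than it gives up, so all receive equally many, and then each received
  object is weakly preferred to \<open>w i\<close>. Sending each agent \<open>i\<close> to the receiver of \<open>w i\<close>
  gives a self-map of a finite set of agents, which permutes some nonempty subset. Passing on the
  objects \<open>w i\<close> along this permutation is a weak improvement for purely ordinal reasons. If it is
  strict for some agent, it is a Pareto improvement under every consistent utility profile;
  otherwise it leaves all utilities unchanged and brings \<open>p\<close> closer to \<open>q\<close>.
\<close>

section \<open>Utilities of a single agent\<close>

text \<open>An injection of \<open>A\<close> into \<open>B\<close> raises every term, and the
  elements of \<open>B\<close> that it misses contribute nonnegative amounts.\<close>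

lemma sum_le_sum_of_card_le:
  fixes v :: "'a \<Rightarrow> real"
  assumes fin: "finite A" "finite B" and card: "card A \<le> card B"
    and le: "\<And>a b. a \<in> A \<Longrightarrow> b \<in> B \<Longrightarrow> v a \<le> v b"
    and nonneg: "\<And>b. b \<in> B \<Longrightarrow> 0 \<le> v b"
  shows "sum v A \<le> sum v B"
proof -
  obtain f where f: "f ` A \<subseteq> B" "inj_on f A"
    using card_le_inj[OF fin card] by blast
  have "sum v A \<le> (\<Sum>a\<in>A. v (f a))"
    using le f(1) by (intro sum_mono) auto
  also have "\<dots> = sum v (f ` A)"
    using f(2) by (simp add: sum.reindex)
  also have "\<dots> \<le> sum v B"
    using f(1) fin nonneg by (intro sum_mono2) auto
  finally show ?thesis .
qed

text \<open>Here \<open>P\<close> is given up and \<open>Q\<close> received. By \<open>max\<close>,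
  with \<open>w\<close> a least valuable element of \<open>P\<close>, nothing in \<open>Q\<close>
  exceeds any element of \<open>P - {w}\<close>. If \<open>Q\<close> were smaller than
  \<open>P\<close>, it would be worth at most \<open>P - {w}\<close>, hence strictly less than
  \<open>P\<close>.\<close>

lemma exchange_card_le:
  fixes v :: "'a \<Rightarrow> real"
  assumes fin: "finite P" "finite Q"
    and pos: "\<And>x. x \<in> P \<Longrightarrow> 0 < v x"
    and max: "\<And>x y z. x \<in> P \<Longrightarrow> y \<in> P \<Longrightarrow> x \<noteq> y \<Longrightarrow> z \<in> Q \<Longrightarrow> v z \<le> max (v x) (v y)"
    and gain: "sum v P \<le> sum v Q"
  shows "card P \<le> card Q"
proof (rule ccontr)
  assume less: "\<not> card P \<le> card Q"
  then have "P \<noteq> {}" by auto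
  then obtain w where w: "w \<in> P" "\<And>x. x \<in> P \<Longrightarrow> v w \<le> v x"
    using ex_is_arg_min_if_finite[OF fin(1), of v] by (auto simp: is_arg_min_linorder)
  have "sum v Q \<le> sum v (P - {w})"
  proof (rule sum_le_sum_of_card_le)
    show "card Q \<le> card (P - {w})" using less w(1) fin by simp
    show "v a \<le> v b" if "a \<in> Q" "b \<in> P - {w}" for a b
      using max[of b w a] that w(1) w(2)[of b] by auto
  qed (use fin pos in \<open>auto intro: less_imp_le\<close>)
  with gain pos[OF w(1)] fin(1) w(1) show False by (simp add: sum_diff1)
qed

text \<open>Removing \<open>w\<close> and \<open>z\<close> leaves sets of equal size in which the
  remaining part of \<open>Q\<close> is worth at most that of \<open>P\<close>. So \<open>z\<close>
  must make up for \<open>w\<close>.\<close>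

lemma exchange_min_le:
  fixes v :: "'a \<Rightarrow> real"
  assumes fin: "finite P" "finite Q"
    and pos: "\<And>x. x \<in> P \<Longrightarrow> 0 < v x"
    and max: "\<And>x y z. x \<in> P \<Longrightarrow> y \<in> P \<Longrightarrow> x \<noteq> y \<Longrightarrow> z \<in> Q \<Longrightarrow> v z \<le> max (v x) (v y)"
    and gain: "sum v P \<le> sum v Q"
    and card: "card P = card Q"
    and w: "w \<in> P" "\<And>x. x \<in> P \<Longrightarrow> v w \<le> v x"
    and z: "z \<in> Q"
  shows "v w \<le> v z"
proof -
  have "sum v (Q - {z}) \<le> sum v (P - {w})"
  proof (rule sum_le_sum_of_card_le)
    show "card (Q - {z}) \<le> card (P - {w})" using card w(1) z fin by simp
    show "v a \<le> v b" if "a \<in> Q - {z}" "b \<in> P - {w}" for a b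
      using max[of b w a] that w(1) w(2)[of b] by auto
  qed (use fin pos in \<open>auto intro: less_imp_le\<close>)
  with gain fin w(1) z show ?thesis by (simp add: sum_diff1)
qed

lemma sum_insert_remove:
  fixes v :: "'a \<Rightarrow> real"
  assumes "finite A" "x \<in> A" "y \<notin> A"
  shows "sum v (insert y (A - {x})) = sum v A - v x + v y"
  using assms by (simp add: sum_diff1)

lemma sum_minus_sum:
  fixes v :: "'a \<Rightarrow> real"
  assumes "finite A" "finite B"
  shows "sum v A - sum v B = sum v (A - B) - sum v (B - A)"
  using sum.Int_Diff[OF assms(1), of v B] sum.Int_Diff[OF assms(2), of v A]
  by (simp add: Int_commute)

section \<open>Exchanges along a permutation\<close>

text \<open>Take a nonempty invariant subset of least cardinality. Its image is again nonempty and
  invariant, so minimality makes \<open>f\<close> onto it, and finiteness makes \<open>f\<close>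
  injective.\<close>

lemma finite_self_map_has_permuted_subset:
  assumes "finite A" "A \<noteq> {}" "f ` A \<subseteq> A"
  shows "\<exists>C\<subseteq>A. C \<noteq> {} \<and> bij_betw f C C"
proof -
  let ?F = "\<lambda>C. C \<subseteq> A \<and> C \<noteq> {} \<and> f ` C \<subseteq> C"
  obtain C where C: "?F C" and least: "\<And>D. ?F D \<Longrightarrow> card C \<le> card D"
    using assms ex_has_least_nat[of ?F A card] by auto
  have fin: "finite C" using C assms(1) finite_subset by blast
  have "?F (f ` C)" using C by auto
  then have "card C \<le> card (f ` C)" by (rule least)
  then have "f ` C = C" using C fin by (meson card_seteq)
  then have "bij_betw f C C"
    using fin eq_card_imp_inj_on[of C f] by (simp add: bij_betw_def)
  then show ?thesis using C by blast
qed

text \<open>Intended for a permutation \<open>g\<close> of \<open>C\<close>: agent \<open>i\<close>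
  passes on \<open>w i\<close> and takes over what agent \<open>g i\<close> gives up.\<close>

definition exchange ::
    "nat set \<Rightarrow> (nat \<Rightarrow> nat) \<Rightarrow> (nat \<Rightarrow> 'o) \<Rightarrow> (nat \<Rightarrow> 'o set) \<Rightarrow> nat \<Rightarrow> 'o set" where
  "exchange C g w p i = (if i \<in> C then insert (w (g i)) (p i - {w i}) else p i)"

section \<open>Basic facts about assignments and their exchanges\<close>

lemma assignment_disjointD:
  assumes "assignment n Obj p" "i \<in> {1..n}" "j \<in> {1..n}" "x \<in> p i" "x \<in> p j"
  shows "i = j"
proof (rule ccontr)
  assume "i \<noteq> j"
  then have "p i \<inter> p j = {}"
    using assms(1-3) unfolding assignment_def disjoint_family_on_def by blast
  with assms(4,5) show False by blast
qed

lemma assignment_subset: "assignment n Obj p \<Longrightarrow> i \<in> {1..n} \<Longrightarrow> p i \<subseteq> Obj"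
  by (auto simp: assignment_def)

lemma assignment_owner:
  assumes "assignment n Obj p" "x \<in> Obj"
  obtains i where "i \<in> {1..n}" "x \<in> p i"
  using assms by (auto simp: assignment_def)

lemma assignmentI:
  assumes "\<And>i. i \<in> {1..n} \<Longrightarrow> p i \<subseteq> Obj"
    and "\<And>x. x \<in> Obj \<Longrightarrow> \<exists>i\<in>{1..n}. x \<in> p i"
    and "\<And>i j x. i \<in> {1..n} \<Longrightarrow> j \<in> {1..n} \<Longrightarrow> x \<in> p i \<Longrightarrow> x \<in> p j \<Longrightarrow> i = j"
  shows "assignment n Obj p"
proof -
  have "p i \<inter> p j = {}" if "i \<in> {1..n}" "j \<in> {1..n}" "i \<noteq> j" for i j
    using assms(3)[OF that(1,2)] that(3) by blast
  moreover have "(\<Union>i\<in>{1..n}. p i) = Obj"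
  proof
    show "(\<Union>i\<in>{1..n}. p i) \<subseteq> Obj" by (rule UN_least) (rule assms(1))
    show "Obj \<subseteq> (\<Union>i\<in>{1..n}. p i)" using assms(2) by auto
  qed
  ultimately show ?thesis by (simp add: assignment_def disjoint_family_on_def)
qed

lemma assignment_sum_card:
  assumes "assignment n Obj p" "finite Obj"
  shows "(\<Sum>i\<in>{1..n}. card (p i)) = card Obj"
proof -
  have "card (\<Union>i\<in>{1..n}. p i) = (\<Sum>i\<in>{1..n}. card (p i))"
  proof (rule card_UN_disjoint)
    show "\<forall>i\<in>{1..n}. finite (p i)"
      using assignment_subset[OF assms(1)] assms(2) finite_subset by blast
    show "\<forall>i\<in>{1..n}. \<forall>j\<in>{1..n}. i \<noteq> j \<longrightarrow> p i \<inter> p j = {}"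
      using assms(1) unfolding assignment_def disjoint_family_on_def by blast
  qed simp
  with assms(1) show ?thesis by (simp add: assignment_def)
qed

text \<open>Surjectivity of \<open>g\<close> ensures that each object given up finds a new owner,
  injectivity that it finds only one.\<close>

lemma assignment_exchange:
  assumes p: "assignment n Obj p" and C: "C \<subseteq> {1..n}" and g: "bij_betw g C C"
    and w: "\<And>i. i \<in> C \<Longrightarrow> w i \<in> p i"
  shows "assignment n Obj (exchange C g w p)"
proof (rule assignmentI)
  have gC: "g i \<in> C" if "i \<in> C" for i using bij_betw_apply[OF g that] .
  have wObj: "w i \<in> Obj" if "i \<in> C" for i
    using assignment_subset[OF p, of i] w[OF that] C that by blast
  show "exchange C g w p i \<subseteq> Obj" if "i \<in> {1..n}" for i
    using assignment_subset[OF p that] wObj[OF gC[of i]] by (auto simp: exchange_def)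
  show "\<exists>i\<in>{1..n}. x \<in> exchange C g w p i" if x: "x \<in> Obj" for x
  proof -
    obtain i where i: "i \<in> {1..n}" "x \<in> p i" using assignment_owner[OF p x] .
    show ?thesis
    proof (cases "i \<in> C \<and> x = w i")
      case True
      then have "i \<in> g ` C" using bij_betw_imp_surj_on[OF g] by simp
      then obtain j where "j \<in> C" "g j = i" by blast
      then have "x \<in> exchange C g w p j" "j \<in> {1..n}"
        using C True by (auto simp: exchange_def)
      then show ?thesis by blast
    next
      case False
      then have "x \<in> exchange C g w p i" using i by (auto simp: exchange_def)
      then show ?thesis using i by blast
    qed
  qed
  have new: "i \<in> C \<and> x = w (g i) \<or> x \<in> p i \<and> \<not> (i \<in> C \<and> x = w i)"
    if "x \<in> exchange C g w p i" for x i
    using that by (auto simp: exchange_def split: if_splits)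
  \<comment> \<open>No object is newly received by one agent and retained by another: the owner of
    \<open>w (g i)\<close> under \<open>p\<close> is \<open>g i\<close>, who has just given it
    away.\<close>
  have mixed: False
    if "j \<in> {1..n}" "i \<in> C" "x = w (g i)" "x \<in> p j" "\<not> (j \<in> C \<and> x = w j)" for i j x
  proof -
    have gi: "g i \<in> C" using gC[OF that(2)] .
    have "g i = j"
      using assignment_disjointD[OF p, of "g i" j x] w[OF gi] gi C that(1,3,4) by blast
    then show False using gi that(3,5) by blast
  qed
  show "i = j" if ij: "i \<in> {1..n}" "j \<in> {1..n}"
    and x: "x \<in> exchange C g w p i" "x \<in> exchange C g w p j" for i j x
  proof -
    consider "i \<in> C" "x = w (g i)" "j \<in> C" "x = w (g j)" | "x \<in> p i" "x \<in> p j"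
      using new[OF x(1)] new[OF x(2)] mixed[OF ij(1), of j x] mixed[OF ij(2), of i x] by blast
    then show ?thesis
    proof cases
      case 1
      then have "g i \<in> C" "g j \<in> C" by (auto intro: gC)
      then have "g i = g j"
        using assignment_disjointD[OF p, of "g i" "g j" x] w[of "g i"] w[of "g j"] C 1(2,4)
        by (metis subsetD)
      then show ?thesis using inj_onD[OF bij_betw_imp_inj_on[OF g]] 1(1,3) by blast
    next
      case 2
      then show ?thesis using assignment_disjointD[OF p ij] by blast
    qed
  qed
qed

section \<open>Transfer of Pareto optimality\<close>

text \<open>The cardinal hypothesis of domination is turned into comparisons of single objects,
  which depend only on the preferences and so carry over to other consistent utilities.\<close>

lemma pareto_dominates_gives_exchange:
  assumes fin: "finite Obj" and p: "assignment n Obj p" and q: "assignment n Obj q"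
    and pos: "\<And>i x. i \<in> {1..n} \<Longrightarrow> x \<in> Obj \<Longrightarrow> 0 < u i x"
    and max: "\<And>i x y z. i \<in> {1..n} \<Longrightarrow> x \<in> p i \<Longrightarrow> y \<in> p i \<Longrightarrow> x \<noteq> y \<Longrightarrow> z \<in> Obj - p i
      \<Longrightarrow> u i z \<le> max (u i x) (u i y)"
    and dom: "pareto_dominates n u q p"
  obtains C g w where "C \<subseteq> {1..n}" "C \<noteq> {}" "bij_betw g C C"
    "\<And>i. i \<in> C \<Longrightarrow> w i \<in> p i - q i" "\<And>i. i \<in> C \<Longrightarrow> w (g i) \<in> q i - p i"
    "\<And>i. i \<in> C \<Longrightarrow> u i (w i) \<le> u i (w (g i))"
proof -
  have pO: "p i \<subseteq> Obj" and qO: "q i \<subseteq> Obj" if "i \<in> {1..n}" for i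
    using assignment_subset[OF p that] assignment_subset[OF q that] by auto
  have fp: "finite (p i)" and fq: "finite (q i)" if "i \<in> {1..n}" for i
    using finite_subset[OF pO[OF that] fin] finite_subset[OF qO[OF that] fin] by auto
  have gain: "sum (u i) (p i - q i) \<le> sum (u i) (q i - p i)" if "i \<in> {1..n}" for i
    using dom sum_minus_sum[OF fq[OF that] fp[OF that], of "u i"] that
    by (force simp: pareto_dominates_def bundle_utility_def)
  have pos': "0 < u i x" if "i \<in> {1..n}" "x \<in> p i - q i" for i x
    using pos[OF that(1)] pO[OF that(1)] that(2) by blast
  have max': "u i z \<le> max (u i x) (u i y)"
    if "i \<in> {1..n}" "x \<in> p i - q i" "y \<in> p i - q i" "x \<noteq> y" "z \<in> q i - p i" for i x y z
    using max[of i x y z] qO[OF that(1)] that by blast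
  have fin': "finite (p i - q i)" "finite (q i - p i)" if "i \<in> {1..n}" for i
    using fp[OF that] fq[OF that] by auto
  have card_le: "card (p i - q i) \<le> card (q i - p i)" if "i \<in> {1..n}" for i
    using exchange_card_le[OF fin'[OF that] pos'[OF that] max'[OF that] gain[OF that]] by blast
  have split: "card A = card (A \<inter> B) + card (A - B)" if "finite A" for A B :: "'a set"
    using card_Int_Diff[OF that] .
  \<comment> \<open>No bundle shrinks from \<open>p\<close> to \<open>q\<close>, while the sizes add
    up to \<open>card Obj\<close> in both assignments. So every inequality is an equality.\<close>
  have card_eq: "card (p i - q i) = card (q i - p i)" if i: "i \<in> {1..n}" for i
  proof -
    have diff: "card (p j) \<le> card (q j)" if "j \<in> {1..n}" for j
      using card_le[OF that] split[OF fp[OF that], of "q j"] split[OF fq[OF that], of "p j"]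
      by (simp add: Int_commute)
    have "card (p i) = card (q i)"
    proof (rule sum_mono_inv[OF _ diff i])
      show "(\<Sum>j\<in>{1..n}. card (p j)) = (\<Sum>j\<in>{1..n}. card (q j))"
        using assignment_sum_card[OF p fin] assignment_sum_card[OF q fin] by simp
    qed auto
    then show ?thesis
      using split[OF fp[OF i], of "q i"] split[OF fq[OF i], of "p i"]
      by (simp add: Int_commute)
  qed
  define A where "A = {i \<in> {1..n}. p i - q i \<noteq> {}}"
  have "\<exists>w. w \<in> p i - q i \<and> (\<forall>x\<in>p i - q i. u i w \<le> u i x)" if "i \<in> A" for i
    using ex_is_arg_min_if_finite[of "p i - q i" "u i"] that fin'
    by (auto simp: is_arg_min_linorder A_def)
  then obtain w where w: "\<And>i. i \<in> A \<Longrightarrow> w i \<in> p i - q i"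
    "\<And>i x. i \<in> A \<Longrightarrow> x \<in> p i - q i \<Longrightarrow> u i (w i) \<le> u i x"
    by metis
  have "\<exists>j\<in>{1..n}. w i \<in> q j" if "i \<in> A" for i
  proof -
    have "w i \<in> Obj" using pO[of i] w(1)[OF that] that by (auto simp: A_def)
    then show ?thesis using assignment_owner[OF q] by blast
  qed
  \<comment> \<open>\<open>f i\<close> is the owner under \<open>q\<close> of the worst object that
    \<open>i\<close> gives up.\<close>
  then obtain f where f: "\<And>i. i \<in> A \<Longrightarrow> f i \<in> {1..n}" "\<And>i. i \<in> A \<Longrightarrow> w i \<in> q (f i)"
    by metis
  have recv: "w i \<in> q (f i) - p (f i)" if "i \<in> A" for i
    using assignment_disjointD[OF p, of i "f i" "w i"] f[OF that] w(1)[OF that] that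
    by (auto simp: A_def)
  \<comment> \<open>Whoever receives something also gives something up, by
    \<open>card_eq\<close>.\<close>
  have fA: "f ` A \<subseteq> A"
  proof
    fix j assume "j \<in> f ` A"
    then obtain i where i: "i \<in> A" "j = f i" by auto
    then have j: "j \<in> {1..n}" using f by simp
    have "card (q j - p j) \<noteq> 0" using recv[OF i(1)] i(2) fin'[OF j] by auto
    then have "p j - q j \<noteq> {}" using card_eq[OF j] by (metis card.empty)
    then show "j \<in> A" using j by (simp add: A_def)
  qed
  have "A \<noteq> {}"
  proof
    assume "A = {}"
    then have sub: "p i \<subseteq> q i" if "i \<in> {1..n}" for i using that by (auto simp: A_def)
    have "p i = q i" if i: "i \<in> {1..n}" for i
    proof -
      have "p i - q i = {}" using sub[OF i] by blast
      then have "card (q i - p i) = 0" using card_eq[OF i] by (metis card.empty)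
      then show ?thesis using sub[OF i] fin'[OF i] by auto
    qed
    then show False using dom by (auto simp: pareto_dominates_def)
  qed
  then obtain C where C: "C \<subseteq> A" "C \<noteq> {}" "bij_betw f C C"
    using finite_self_map_has_permuted_subset[of A f] fA by (auto simp: A_def)
  \<comment> \<open>\<open>f\<close> points from giver to receiver, whereas an exchange needs the
    giver from whom \<open>i\<close> receives; hence the inverse.\<close>
  define g where "g = the_inv_into C f"
  have g: "bij_betw g C C" unfolding g_def by (rule bij_betw_the_inv_into[OF C(3)])
  have fg: "f (g i) = i" if "i \<in> C" for i
    using C(3) that unfolding g_def by (simp add: f_the_inv_into_f_bij_betw)
  have gC: "g i \<in> C" if "i \<in> C" for i using bij_betw_apply[OF g that] .
  have recv': "w (g i) \<in> q i - p i" if "i \<in> C" for i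
    using recv[of "g i"] gC[OF that] fg[OF that] C(1) by auto
  show thesis
  proof
    show "C \<subseteq> {1..n}" using C(1) by (auto simp: A_def)
    show "w i \<in> p i - q i" if "i \<in> C" for i using w(1) C(1) that by blast
    show "u i (w i) \<le> u i (w (g i))" if "i \<in> C" for i
    proof -
      have iA: "i \<in> A" and i: "i \<in> {1..n}" using C(1) that by (auto simp: A_def)
      show ?thesis
        using exchange_min_le[OF fin'[OF i] pos'[OF i] max'[OF i] gain[OF i] card_eq[OF i]
            w(1)[OF iA] w(2)[OF iA] recv'[OF that]] by blast
    qed
  qed (use C g recv' in auto)
qed

text \<open>Induction on the number of objects that change hands between \<open>p\<close> and
  \<open>q\<close>. The conditions on \<open>p\<close> are premises of the conclusion because the
  induction replaces \<open>p\<close> by the exchanged assignment, for which they must be proved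
  again.\<close>

lemma pareto_optimal_transfer:
  assumes fin: "finite Obj" and q: "assignment n Obj q"
    and pos: "\<And>i x. i \<in> {1..n} \<Longrightarrow> x \<in> Obj \<Longrightarrow> 0 < u i x"
    and ord: "\<And>i x y. i \<in> {1..n} \<Longrightarrow> x \<in> Obj \<Longrightarrow> y \<in> Obj \<Longrightarrow> u i x \<le> u i y \<longleftrightarrow> u' i x \<le> u' i y"
  shows "assignment n Obj p
    \<Longrightarrow> (\<And>i x y z. i \<in> {1..n} \<Longrightarrow> x \<in> p i \<Longrightarrow> y \<in> p i \<Longrightarrow> x \<noteq> y \<Longrightarrow> z \<in> Obj - p i
      \<Longrightarrow> u i z \<le> max (u i x) (u i y))
    \<Longrightarrow> pareto_optimal n Obj u' p \<Longrightarrow> \<not> pareto_dominates n u q p"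
proof (induction "\<Sum>i\<in>{1..n}. card (p i - q i)" arbitrary: p rule: less_induct)
  case less
  note p = less.prems(1) and max = less.prems(2) and po = less.prems(3)
  show ?case
  proof
    assume dom: "pareto_dominates n u q p"
    obtain C g w where C: "C \<subseteq> {1..n}" "C \<noteq> {}" and g: "bij_betw g C C"
      and w: "\<And>i. i \<in> C \<Longrightarrow> w i \<in> p i - q i" and wg: "\<And>i. i \<in> C \<Longrightarrow> w (g i) \<in> q i - p i"
      and le: "\<And>i. i \<in> C \<Longrightarrow> u i (w i) \<le> u i (w (g i))"
      by (rule pareto_dominates_gives_exchange[OF fin p q _ _ dom])
        (rule pos max that; assumption)+
    define p' where "p' = exchange C g w p"
    have p': "assignment n Obj p'"
      unfolding p'_def using assignment_exchange[OF p C(1) g] w by blast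
    have fp: "finite (p i)" if "i \<in> {1..n}" for i
      using finite_subset[OF assignment_subset[OF p that] fin] .
    have wO: "w i \<in> Obj" "w (g i) \<in> Obj" if "i \<in> C" for i
      using assignment_subset[OF p, of i] assignment_subset[OF q, of i] w wg that C by blast+
    have le': "u' i (w i) \<le> u' i (w (g i))" if "i \<in> C" for i
      using le[OF that] ord[of i "w i" "w (g i)"] wO[OF that] C(1) that by blast
    have util: "bundle_utility (v i) (p' i) =
        (if i \<in> C then bundle_utility (v i) (p i) - v i (w i) + v i (w (g i))
         else bundle_utility (v i) (p i))" if "i \<in> {1..n}" for i and v :: "nat \<Rightarrow> 'a \<Rightarrow> real"
    proof (cases "i \<in> C")
      case True
      then show ?thesis
        using sum_insert_remove[of "p i" "w i" "w (g i)" "v i"] w wg fp[OF that]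
        by (simp add: bundle_utility_def p'_def exchange_def)
    qed (simp add: p'_def exchange_def)
    \<comment> \<open>By \<open>le'\<close> nobody loses under \<open>u'\<close>, so a single strict
      gain would contradict optimality of \<open>p\<close> for \<open>u'\<close>.\<close>
    have eq': "u' i (w i) = u' i (w (g i))" if i: "i \<in> C" for i
    proof (rule ccontr)
      assume "u' i (w i) \<noteq> u' i (w (g i))"
      then have "u' i (w i) < u' i (w (g i))" using le'[OF i] by simp
      then have "pareto_dominates n u' p' p"
        unfolding pareto_dominates_def using util[of _ u'] le' C(1) i by (auto intro!: bexI[of _ i])
      then show False using po p' by (auto simp: pareto_optimal_def)
    qed
    have eq: "u i (w i) = u i (w (g i))" if i: "i \<in> C" for i
      using eq'[OF i] le[OF i] ord[of i "w (g i)" "w i"] wO[OF i] C(1) i by force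
    have same: "bundle_utility (u i) (p' i) = bundle_utility (u i) (p i)"
      "bundle_utility (u' i) (p' i) = bundle_utility (u' i) (p i)" if "i \<in> {1..n}" for i
      using util[OF that, of u] util[OF that, of u'] eq eq' by auto
    \<comment> \<open>The exchange is neutral under both profiles. Each agent in \<open>C\<close>
      sheds \<open>w i\<close>, which is not in \<open>q i\<close>, and gains an element of
      \<open>q i\<close>, so the measure drops.\<close>
    have "\<not> pareto_dominates n u q p'"
    proof (rule less.hyps)
      have "card (p' i - q i) < card (p i - q i)" if "i \<in> C" for i
      proof -
        have "p' i - q i = (p i - q i) - {w i}"
          using wg[OF that] that by (auto simp: p'_def exchange_def)
        moreover have "finite (p i - q i)" using fp[of i] C(1) that by blast
        ultimately show ?thesis using card_Diff1_less[OF _ w[OF that]] by simp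
      qed
      moreover have "card (p' i - q i) = card (p i - q i)" if "i \<notin> C" for i
        using that by (simp add: p'_def exchange_def)
      ultimately show "(\<Sum>i\<in>{1..n}. card (p' i - q i)) < (\<Sum>i\<in>{1..n}. card (p i - q i))"
        using C by (intro sum_strict_mono_ex1) (auto simp: le_less)
      show "pareto_optimal n Obj u' p'"
        using po same(2) by (simp add: pareto_optimal_def pareto_dominates_def)
      fix i x y z
      assume i: "i \<in> {1..n}" and xyz: "x \<in> p' i" "y \<in> p' i" "x \<noteq> y" "z \<in> Obj - p' i"
      show "u i z \<le> max (u i x) (u i y)"
      proof (cases "i \<in> C")
        case True
        \<comment> \<open>This transposition preserves \<open>u i\<close> and takes
          \<open>p' i\<close> back to \<open>p i\<close>, so the bound known for \<open>p\<close>
          yields the one for \<open>p'\<close>.\<close>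
        let ?t = "\<lambda>x. if x = w i then w (g i) else if x = w (g i) then w i else x"
        have t: "u i (?t a) = u i a" for a using eq[OF True] by auto
        have "?t x \<in> p i" "?t y \<in> p i" "?t x \<noteq> ?t y" "?t z \<in> Obj - p i"
          using xyz True w[OF True] wg[OF True] wO[OF True]
          by (auto simp: p'_def exchange_def split: if_splits)
        from max[OF i this] show ?thesis unfolding t .
      next
        case False
        then show ?thesis using max[OF i] xyz by (simp add: p'_def exchange_def)
      qed
    qed (rule p')
    moreover have "pareto_dominates n u q p'"
      using dom same(1) by (simp add: pareto_dominates_def)
    ultimately show False ..
  qed
qed

section \<open>Utilities from ranks\<close>

text \<open>Counting the objects weakly below \<open>x\<close> makes better objects rank higher and
  indifferent ones rank equally.\<close>

definition rank :: "'o set \<Rightarrow> ('o \<Rightarrow> 'o \<Rightarrow> bool) \<Rightarrow> 'o \<Rightarrow> nat" where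
  "rank Obj r x = card {y \<in> Obj. r x y}"

lemma rank_le_iff:
  assumes fin: "finite Obj" and r: "reflp_on Obj r" "transp_on Obj r" "totalp_on Obj r"
    and x: "x \<in> Obj" and y: "y \<in> Obj"
  shows "rank Obj r y \<le> rank Obj r x \<longleftrightarrow> r x y"
proof -
  have total: "r a b \<or> r b a" if "a \<in> Obj" "b \<in> Obj" for a b
    using r(1,3) that by (metis reflp_onD totalp_onD)
  have sub: "{z \<in> Obj. r b z} \<subseteq> {z \<in> Obj. r a z}" if "a \<in> Obj" "b \<in> Obj" "r a b" for a b
    using transp_onD[OF r(2)] that by blast
  show ?thesis
  proof
    assume "r x y"
    then show "rank Obj r y \<le> rank Obj r x"
      using sub[OF x y] fin by (auto simp: rank_def intro!: card_mono)
  next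
    assume le: "rank Obj r y \<le> rank Obj r x"
    show "r x y"
    proof (rule ccontr)
      assume not: "\<not> r x y"
      then have "r y x" using total x y by blast
      then have "{z \<in> Obj. r x z} \<subset> {z \<in> Obj. r y z}"
        using sub[OF y x] not y reflp_onD[OF r(1) y] by blast
      then have "rank Obj r x < rank Obj r y"
        using fin by (auto simp: rank_def intro!: psubset_card_mono)
      with le show False by simp
    qed
  qed
qed

text \<open>The scale \<open>h i\<close> may differ between agents, which lets the two parties to a
  swap have utilities of opposite character.\<close>

lemma utility_profiles_rank:
  fixes h :: "nat \<Rightarrow> nat \<Rightarrow> real"
  assumes "finite Obj" "preference_profile n Obj R"
    and "\<And>i. strict_mono (h i)" "\<And>i k. 0 < h i k"
  shows "(\<lambda>i x. h i (rank Obj (R i) x)) \<in> utility_profiles n Obj R"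
  using assms(2-4) rank_le_iff[OF assms(1)]
  by (auto simp: utility_profiles_def preference_profile_def strict_mono_less_eq)

lemma swap_not_necessarily_pareto_optimal:
  assumes fin: "finite Obj" and R: "preference_profile n Obj R" and p: "assignment n Obj p"
    and swap: "admits_one_for_two_swap n R p"
  shows "\<not> necessarily_pareto_optimal n Obj R p"
proof -
  obtain j k x y z where jk: "j \<in> {1..n}" "k \<in> {1..n}" "j \<noteq> k"
    and xyz: "x \<in> p j" "y \<in> p j" "z \<in> p k" "x \<noteq> y" "strict_pref (R j) z x" "R j x y"
    using swap by (auto simp: admits_one_for_two_swap_def)
  \<comment> \<open>With base 3, two objects of rank at most \<open>m\<close> are together worth at
    most \<open>2 * 3 ^ m\<close>, less than one object of rank \<open>m + 1\<close>. On the other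
    scale all values lie in the interval from 1 to 2, with 2 excluded, so any two objects outweigh
    any single one.\<close>
  define h :: "nat \<Rightarrow> nat \<Rightarrow> real"
    where "h i m = (if i = j then 3 ^ m else 2 - 1 / (real m + 1))" for i m
  define u where "u = (\<lambda>i x. h i (rank Obj (R i) x))"
  have "strict_mono (h i)" for i
    by (auto simp: h_def strict_mono_def frac_less2)
  moreover have "0 < h i m" for i m
    by (auto simp: h_def field_simps add_pos_nonneg)
  ultimately have u: "u \<in> utility_profiles n Obj R"
    unfolding u_def by (intro utility_profiles_rank[OF fin R])
  have O: "x \<in> Obj" "y \<in> Obj" "z \<in> Obj"
    using assignment_subset[OF p] jk xyz by blast+
  have notin: "z \<notin> p j" "x \<notin> p k" "y \<notin> p k"
    using assignment_disjointD[OF p] jk xyz by blast+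
  have "u j z > u j x + u j y"
  proof -
    have r: "reflp_on Obj (R j)" "transp_on Obj (R j)" "totalp_on Obj (R j)"
      using R jk(1) by (auto simp: preference_profile_def)
    have "Suc (rank Obj (R j) x) \<le> rank Obj (R j) z"
      using rank_le_iff[OF fin r O(1) O(3)] xyz(5) by (auto simp: strict_pref_def)
    then have "(3::real) ^ Suc (rank Obj (R j) x) \<le> 3 ^ rank Obj (R j) z"
      by (intro power_increasing) auto
    moreover have "(3::real) ^ rank Obj (R j) y \<le> 3 ^ rank Obj (R j) x"
      using rank_le_iff[OF fin r O(1) O(2)] xyz(6) by (intro power_increasing) auto
    moreover have "(0::real) < 3 ^ rank Obj (R j) x" by simp
    ultimately show ?thesis
      unfolding u_def h_def power_Suc by (simp only: if_True refl)
  qed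
  moreover have "u k z < u k x + u k y"
  proof -
    have "1 / (real m + 1) \<le> 1" "0 < 1 / (real m + 1)" for m
      by (auto simp: field_simps)
    then have "u k a \<ge> 1" "u k a < 2" for a
      using jk(3) by (auto simp: u_def h_def)
    from this(1)[of x] this(1)[of y] this(2)[of z] show ?thesis by linarith
  qed
  moreover define q where "q = p(j := insert z (p j - {x, y}), k := p k - {z} \<union> {x, y})"
  have "bundle_utility (u j) (q j) = bundle_utility (u j) (p j) - u j x - u j y + u j z"
    "bundle_utility (u k) (q k) = bundle_utility (u k) (p k) - u k z + u k x + u k y"
  proof -
    have f: "finite (p j)" "finite (p k)"
      using assignment_subset[OF p] jk fin finite_subset by blast+
    have "p j - {x, y} = p j - {x} - {y}" by auto
    then show "bundle_utility (u j) (q j) = bundle_utility (u j) (p j) - u j x - u j y + u j z"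
      using jk(3) notin f xyz by (simp add: bundle_utility_def q_def sum_diff1)
    show "bundle_utility (u k) (q k) = bundle_utility (u k) (p k) - u k z + u k x + u k y"
      using jk(3) notin f xyz by (simp add: bundle_utility_def q_def sum_diff1)
  qed
  moreover have "q i = p i" if "i \<noteq> j" "i \<noteq> k" for i using that by (simp add: q_def)
  ultimately have "pareto_dominates n u q p"
    unfolding pareto_dominates_def using jk by (smt (verit))
  moreover have "assignment n Obj q"
  proof (rule assignmentI)
    show "q i \<subseteq> Obj" if "i \<in> {1..n}" for i
      using assignment_subset[OF p that] O by (auto simp: q_def)
    show "\<exists>i\<in>{1..n}. a \<in> q i" if a: "a \<in> Obj" for a
    proof -
      obtain i where "i \<in> {1..n}" "a \<in> p i" using assignment_owner[OF p a] .
      then show ?thesis using jk by (cases "a = z"; cases "a = x \<or> a = y") (auto simp: q_def)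
    qed
    show "i = i'" if "i \<in> {1..n}" "i' \<in> {1..n}" "a \<in> q i" "a \<in> q i'" for i i' a
    proof -
      have excl: "x \<in> p l \<Longrightarrow> l = j" "y \<in> p l \<Longrightarrow> l = j" "z \<in> p l \<Longrightarrow> l = k" if "l \<in> {1..n}" for l
        using assignment_disjointD[OF p that] jk xyz by blast+
      have new: "a \<in> {x, y} \<and> l = k \<or> a = z \<and> l = j \<or> a \<notin> {x, y, z} \<and> a \<in> p l"
        if "l \<in> {1..n}" "a \<in> q l" for l
        using that(2) excl[OF that(1)] notin jk(3) by (auto simp: q_def split: if_splits)
      show ?thesis
        using new[OF that(1,3)] new[OF that(2,4)] notin xyz(1,2)
          assignment_disjointD[OF p that(1,2), of a] by blast
    qed
  qed
  ultimately show ?thesis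
    using u by (auto simp: necessarily_pareto_optimal_def pareto_optimal_def)
qed

section \<open>The characterization of necessary Pareto optimality\<close>

theorem theorem9:
  fixes n :: nat
    and Obj :: "'o set"
    and R :: "nat \<Rightarrow> 'o \<Rightarrow> 'o \<Rightarrow> bool"
    and p :: "nat \<Rightarrow> 'o set"
  assumes "finite Obj"
    and "preference_profile n Obj R"
    and "assignment n Obj p"
  shows "necessarily_pareto_optimal n Obj R p \<longleftrightarrow>
    possibly_pareto_optimal n Obj R p \<and> \<not> admits_one_for_two_swap n R p"
proof (intro iffI conjI)
  assume nec: "necessarily_pareto_optimal n Obj R p"
  \<comment> \<open>Passing from every profile to some profile requires a consistent one to exist.
    Adding 1 gives positivity at argument 0 too, as \<open>utility_profiles_rank\<close>
    asks.\<close>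
  have "(\<lambda>i x. real (rank Obj (R i) x) + 1) \<in> utility_profiles n Obj R"
    using utility_profiles_rank[OF assms(1,2), of "\<lambda>i m. real m + 1"]
    by (simp add: strict_mono_def add_nonneg_pos)
  then show "possibly_pareto_optimal n Obj R p"
    using nec by (auto simp: necessarily_pareto_optimal_def possibly_pareto_optimal_def)
  show "\<not> admits_one_for_two_swap n R p"
    using swap_not_necessarily_pareto_optimal[OF assms] nec by blast
next
  assume "possibly_pareto_optimal n Obj R p \<and> \<not> admits_one_for_two_swap n R p"
  then obtain u' where u': "u' \<in> utility_profiles n Obj R" "pareto_optimal n Obj u' p"
    and no_swap: "\<not> admits_one_for_two_swap n R p"
    by (auto simp: possibly_pareto_optimal_def)
  show "necessarily_pareto_optimal n Obj R p"
    unfolding necessarily_pareto_optimal_def pareto_optimal_def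
  proof (intro ballI notI, elim exE conjE)
    fix u q
    assume u: "u \<in> utility_profiles n Obj R"
      and q: "assignment n Obj q" and dom: "pareto_dominates n u q p"
    have u_iff: "R i x y \<longleftrightarrow> u i y \<le> u i x" and u'_iff: "R i x y \<longleftrightarrow> u' i y \<le> u' i x"
      if "i \<in> {1..n}" "x \<in> Obj" "y \<in> Obj" for i x y
      using u u'(1) that by (auto simp: utility_profiles_def)
    have "\<not> pareto_dominates n u q p"
    proof (rule pareto_optimal_transfer[OF assms(1) q _ _ assms(3) _ u'(2)])
      show "0 < u i x" if "i \<in> {1..n}" "x \<in> Obj" for i x
        using u that by (auto simp: utility_profiles_def)
      show "u i x \<le> u i y \<longleftrightarrow> u' i x \<le> u' i y" if "i \<in> {1..n}" "x \<in> Obj" "y \<in> Obj" for i x y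
        using u_iff u'_iff that by blast
      fix i x y z
      assume i: "i \<in> {1..n}" and xyz: "x \<in> p i" "y \<in> p i" "x \<noteq> y" "z \<in> Obj - p i"
      obtain k where k: "k \<in> {1..n}" "z \<in> p k"
        using assignment_owner[OF assms(3), of z] xyz(4) by blast
      have ik: "i \<noteq> k" using k xyz(4) by blast
      have O: "x \<in> Obj" "y \<in> Obj" "z \<in> Obj"
        using assignment_subset[OF assms(3) i] xyz by auto
      \<comment> \<open>Here \<open>a\<close> is the better of the two objects. If \<open>z\<close>
        beat it, giving \<open>a\<close> and \<open>b\<close> for \<open>z\<close> would be a
        one-for-two swap with the owner \<open>k\<close> of \<open>z\<close>.\<close>
      have bound: "u i z \<le> u i a"
        if "a \<in> p i" "b \<in> p i" "a \<noteq> b" "a \<in> Obj" "b \<in> Obj" "u i b \<le> u i a" for a b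
      proof (rule ccontr)
        assume "\<not> u i z \<le> u i a"
        then have "strict_pref (R i) z a" "R i a b"
          using u_iff[OF i] that O(3) by (auto simp: strict_pref_def)
        then show False
          using no_swap i k ik that unfolding admits_one_for_two_swap_def by blast
      qed
      show "u i z \<le> max (u i x) (u i y)"
        using bound[of x y] bound[of y x] xyz O by (cases "u i y \<le> u i x") auto
    qed
    with dom show False by blast
  qed
qed

end
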